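(* Let $(X,\rho)$ be a non-empty complete metric space and let $\mathcal{F}=\{S,T\}$ be a commuting contractive family of self-maps of $X$. Then precisely one point of $X$ is fixed by both $S$ and $T$.
   Context: A self-map of a metric space $X$ is a continuous function $X\to X$. For $\gamma\in(0,1)$, a finite family $\mathcal{F}$ of self-maps of a complete metric space $(X,\rho)$ is $\gamma$-contractive if for any $x,y\in X$ there is $U\in\mathcal{F}$ with $\rho(U(x),U(y))\le\gamma\rho(x,y)$. The family is contractive if it is $\gamma$-contractive for some $\gamma\in(0,1)$. It is commuting if $U\circ V=V\circ U$ for all $U,V\in\mathcal{F}$. *)

theory Defs
  imports "HOL-Analysis.Analysis"
begin

text \<open>
  The metric space is given by a carrier \<open>M\<close> and a distance \<open>d\<close>. Values of maps outside
  \<open>M\<close> are irrelevant, so commutation is required on \<open>M\<close> only. A map which is continuous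
  from \<open>mtopology\<close> to itself sends \<open>M\<close> into \<open>M\<close>.
\<close>

context Metric_space
begin

definition self_map :: "('a \<Rightarrow> 'a) \<Rightarrow> bool" where
  "self_map U \<longleftrightarrow> continuous_map mtopology mtopology U"

definition gamma_contractive :: "real \<Rightarrow> ('a \<Rightarrow> 'a) set \<Rightarrow> bool" where
  "gamma_contractive \<gamma> \<F> \<longleftrightarrow>
     0 < \<gamma> \<and> \<gamma> < 1 \<and> finite \<F> \<and> (\<forall>U\<in>\<F>. self_map U) \<and>
     (\<forall>x\<in>M. \<forall>y\<in>M. \<exists>U\<in>\<F>. d (U x) (U y) \<le> \<gamma> * d x y)"

definition contractive :: "('a \<Rightarrow> 'a) set \<Rightarrow> bool" where
  "contractive \<F> \<longleftrightarrow> (\<exists>\<gamma>. gamma_contractive \<gamma> \<F>)"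

definition commuting :: "('a \<Rightarrow> 'a) set \<Rightarrow> bool" where
  "commuting \<F> \<longleftrightarrow> (\<forall>U\<in>\<F>. \<forall>V\<in>\<F>. \<forall>x\<in>M. U (V x) = V (U x))"

end

end

theory Submission
  imports Defs
begin

text \<open>
  Contractivity applied to \<open>x\<close> and \<open>S x\<close>, together with commutation, yields a path \<open>z\<close> each of
  whose steps is \<open>S\<close> or \<open>T\<close> and along which \<open>d (z k) (S (z k))\<close> decays geometrically.
  If the steps are eventually all \<open>S\<close>, the path converges to a fixed point of \<open>S\<close>, and \<open>T\<close> is a
  contraction on the set of such points. Otherwise let \<open>y 0, y 1, \<dots>\<close> be the points at which a
  step \<open>T\<close> occurs. Then \<open>S (y j)\<close> is close to \<open>y j\<close>, and \<open>y (j + 1)\<close> is close to \<open>T (y j)\<close>. Since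
  \<open>S\<close> hardly moves \<open>y j\<close> and \<open>y (j + 1)\<close>, it cannot contract their distance unless that distance
  is already small; hence \<open>T\<close> contracts it, and \<open>d (y j) (y (j + 1))\<close> becomes small, and with it
  \<open>d (y j) (T (y j))\<close>. In both cases there are points which \<open>S\<close> and \<open>T\<close> move arbitrarily little,
  and by contractivity such points form a Cauchy sequence.
\<close>

section \<open>Geometrically decaying steps and limits in a metric space\<close>

lemma (in Metric_space) geometric_chain_dist:
  fixes \<gamma> C :: real
  assumes "0 < \<gamma>" "\<gamma> < 1" "0 \<le> C" and "m \<le> n" and \<sigma>: "\<And>k. \<sigma> k \<in> M"
    and step: "\<And>k. m \<le> k \<Longrightarrow> k < n \<Longrightarrow> d (\<sigma> k) (\<sigma> (Suc k)) \<le> \<gamma> ^ k * C"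
  shows "d (\<sigma> m) (\<sigma> n) \<le> \<gamma> ^ m * (C / (1 - \<gamma>))"
proof -
  \<comment> \<open>The induction needs the sharper bound with
    \<open>\<gamma> ^ m - \<gamma> ^ n\<close>, which telescopes: the summand
    \<open>\<gamma> ^ n * C\<close> is the increment of this bound from \<open>n\<close> to
    \<open>Suc n\<close>.\<close>
  have "d (\<sigma> m) (\<sigma> n) \<le> (\<gamma> ^ m - \<gamma> ^ n) * (C / (1 - \<gamma>))"
    using \<open>m \<le> n\<close> step
  proof (induction n rule: dec_induct)
    case base
    then show ?case by (simp add: \<sigma>)
  next
    case (step n)
    have "d (\<sigma> m) (\<sigma> (Suc n)) \<le> d (\<sigma> m) (\<sigma> n) + d (\<sigma> n) (\<sigma> (Suc n))"
      by (intro triangle \<sigma>)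
    also have "\<dots> \<le> (\<gamma> ^ m - \<gamma> ^ n) * (C / (1 - \<gamma>)) + \<gamma> ^ n * C"
      using step by (intro add_mono) auto
    also have "\<gamma> ^ n * C = (\<gamma> ^ n - \<gamma> ^ Suc n) * (C / (1 - \<gamma>))"
      using \<open>\<gamma> < 1\<close> by (simp add: field_simps)
    finally show ?case by (simp add: algebra_simps)
  qed
  also have "\<dots> \<le> \<gamma> ^ m * (C / (1 - \<gamma>))"
    using assms by (intro mult_right_mono) auto
  finally show ?thesis .
qed

lemma power_mult_arbitrarily_small:
  fixes \<gamma> B \<epsilon> :: real
  assumes "0 < \<gamma>" "\<gamma> < 1" "0 < \<epsilon>"
  shows "\<exists>N. \<forall>n\<ge>N. \<gamma> ^ n * B < \<epsilon>"
proof -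
  have "(\<lambda>n. \<gamma> ^ n * B) \<longlonglongrightarrow> 0"
    using assms by (intro tendsto_mult_left_zero LIMSEQ_realpow_zero) auto
  from order_tendstoD(2)[OF this \<open>0 < \<epsilon>\<close>] show ?thesis
    by (simp add: eventually_sequentially)
qed

lemma (in Metric_space) geometric_steps_MCauchy:
  fixes \<gamma> C :: real
  assumes "0 < \<gamma>" "\<gamma> < 1" "0 \<le> C" and \<sigma>: "\<And>k. \<sigma> k \<in> M"
    and step: "\<And>k. d (\<sigma> k) (\<sigma> (Suc k)) \<le> \<gamma> ^ k * C"
  shows "MCauchy \<sigma>"
  unfolding MCauchy_def
proof (intro conjI allI impI)
  fix \<epsilon> :: real assume "0 < \<epsilon>"
  then obtain N where N: "\<And>n. n \<ge> N \<Longrightarrow> \<gamma> ^ n * (C / (1 - \<gamma>)) < \<epsilon>"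
    using power_mult_arbitrarily_small assms by metis
  have *: "d (\<sigma> m) (\<sigma> n) < \<epsilon>" if "N \<le> m" "m \<le> n" for m n
    using geometric_chain_dist[OF assms(1-3) \<open>m \<le> n\<close> \<sigma> step] N[OF \<open>N \<le> m\<close>] by simp
  show "\<exists>N. \<forall>n n'. N \<le> n \<longrightarrow> N \<le> n' \<longrightarrow> d (\<sigma> n) (\<sigma> n') < \<epsilon>"
    using * commute by (metis nle_le)
qed (use \<sigma> in auto)

lemma (in Metric_space) limit_of_displacement_null_fixed:
  assumes cont: "continuous_map mtopology mtopology U"
    and lim: "limitin mtopology \<sigma> a sequentially"
    and \<sigma>: "\<And>n. \<sigma> n \<in> M"
    and null: "(\<lambda>n. d (\<sigma> n) (U (\<sigma> n))) \<longlonglongrightarrow> 0"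
  shows "U a = a"
proof -
  have U: "U x \<in> M" if "x \<in> M" for x
    using cont that by (auto simp: continuous_map_def)
  have a: "a \<in> M" and "(\<lambda>n. d (\<sigma> n) a) \<longlonglongrightarrow> 0"
    using lim by (auto simp: limitin_metric_dist_null)
  moreover have "limitin mtopology (U \<circ> \<sigma>) (U a) sequentially"
    using continuous_map_limit[OF cont lim] .
  then have "(\<lambda>n. d (U (\<sigma> n)) (U a)) \<longlonglongrightarrow> 0"
    by (auto simp: limitin_metric_dist_null)
  ultimately have "(\<lambda>n. d (\<sigma> n) a + d (\<sigma> n) (U (\<sigma> n)) + d (U (\<sigma> n)) (U a)) \<longlonglongrightarrow> 0"
    using null by (auto intro!: tendsto_eq_intros)
  moreover have "d a (U a) \<le> d (\<sigma> n) a + d (\<sigma> n) (U (\<sigma> n)) + d (U (\<sigma> n)) (U a)" for n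
    using triangle[of a "\<sigma> n" "U a"] triangle[of "\<sigma> n" "U (\<sigma> n)" "U a"] a \<sigma> U
    by (simp add: commute)
  ultimately have "d a (U a) \<le> 0"
    by (intro LIMSEQ_le_const) auto
  then show ?thesis
    using a U by (metis mdist_pos_less not_le)
qed

section \<open>Points that \<open>S\<close> and \<open>T\<close> barely move\<close>

locale commuting_contractive_pair = Metric_space M d for M :: "'a set" and d +
  fixes S T :: "'a \<Rightarrow> 'a" and \<gamma> :: real
  assumes S_cont: "continuous_map mtopology mtopology S"
    and T_cont: "continuous_map mtopology mtopology T"
    and ST: "x \<in> M \<Longrightarrow> S (T x) = T (S x)"
    and gamma_pos: "0 < \<gamma>" and gamma_less: "\<gamma> < 1"
    and contr: "\<lbrakk>x \<in> M; y \<in> M\<rbrakk> \<Longrightarrow> d (S x) (S y) \<le> \<gamma> * d x y \<or> d (T x) (T y) \<le> \<gamma> * d x y"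
begin

lemma S_in [simp]: "x \<in> M \<Longrightarrow> S x \<in> M"
  using S_cont by (auto simp: continuous_map_def)

lemma T_in [simp]: "x \<in> M \<Longrightarrow> T x \<in> M"
  using T_cont by (auto simp: continuous_map_def)

text \<open>Going from \<open>x\<close> to \<open>y\<close> via \<open>U x\<close> and
  \<open>U y\<close> costs at most \<open>2 * \<epsilon> + \<gamma> * d x y\<close>. Read directly,
  almost fixed points are close together; read contrapositively, a map that hardly moves two distant
  points cannot contract their distance.\<close>

lemma dist_le_if_contracted:
  assumes "x \<in> M" "y \<in> M" "U x \<in> M" "U y \<in> M"
    and "d (U x) (U y) \<le> \<gamma> * d x y" "d x (U x) \<le> \<epsilon>" "d y (U y) \<le> \<epsilon>"
  shows "d x y \<le> 2 * \<epsilon> / (1 - \<gamma>)"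
proof -
  have "d x y \<le> d x (U x) + d (U x) (U y) + d y (U y)"
    using triangle[of x "U x" y] triangle[of "U x" "U y" y] assms by (simp add: commute)
  then have "d x y * (1 - \<gamma>) \<le> 2 * \<epsilon>"
    using assms by (simp add: algebra_simps)
  then show ?thesis
    using gamma_less by (simp add: pos_le_divide_eq)
qed

text \<open>Whichever map contracts a pair of almost fixed points,
  \<open>dist_le_if_contracted\<close> makes the pair close. So almost fixed points of growing
  quality form a Cauchy sequence, and continuity makes its limit fixed by both maps.\<close>

lemma common_fixed_point_if_almost_fixed:
  assumes "mcomplete"
    and almost: "\<And>\<epsilon>. 0 < \<epsilon> \<Longrightarrow> \<exists>x\<in>M. d x (S x) \<le> \<epsilon> \<and> d x (T x) \<le> \<epsilon>"
  shows "\<exists>x\<in>M. S x = x \<and> T x = x"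
proof -
  define e where "e n = inverse (real (Suc n))" for n
  have e_pos: "0 < e n" for n
    by (simp add: e_def)
  have e0: "e \<longlonglongrightarrow> 0"
    unfolding e_def by (rule LIMSEQ_inverse_real_of_nat)
  obtain \<sigma> where \<sigma>: "\<And>n. \<sigma> n \<in> M"
    and \<sigma>S: "\<And>n. d (\<sigma> n) (S (\<sigma> n)) \<le> e n" and \<sigma>T: "\<And>n. d (\<sigma> n) (T (\<sigma> n)) \<le> e n"
    using almost[OF e_pos] by metis
  have "MCauchy \<sigma>"
    unfolding MCauchy_def
  proof (intro conjI allI impI)
    fix \<epsilon> :: real assume "0 < \<epsilon>"
    then have "0 < \<epsilon> * (1 - \<gamma>) / 2"
      using gamma_less by simp
    then obtain N where N: "\<And>n. n \<ge> N \<Longrightarrow> e n < \<epsilon> * (1 - \<gamma>) / 2"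
      using order_tendstoD(2)[OF e0] by (metis eventually_sequentially)
    have "d (\<sigma> m) (\<sigma> n) < \<epsilon>" if "N \<le> m" "N \<le> n" for m n
    proof -
      let ?\<delta> = "max (e m) (e n)"
      have S: "d (\<sigma> m) (S (\<sigma> m)) \<le> ?\<delta>" "d (\<sigma> n) (S (\<sigma> n)) \<le> ?\<delta>"
        and T: "d (\<sigma> m) (T (\<sigma> m)) \<le> ?\<delta>" "d (\<sigma> n) (T (\<sigma> n)) \<le> ?\<delta>"
        using \<sigma>S[of m] \<sigma>S[of n] \<sigma>T[of m] \<sigma>T[of n] by linarith+
      have "d (\<sigma> m) (\<sigma> n) \<le> 2 * ?\<delta> / (1 - \<gamma>)"
        using contr[OF \<sigma> \<sigma>, of m n] dist_le_if_contracted[OF \<sigma> \<sigma> _ _ _ S]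
          dist_le_if_contracted[OF \<sigma> \<sigma> _ _ _ T] \<sigma> by auto
      also have "\<dots> < \<epsilon>"
        using N[OF \<open>N \<le> m\<close>] N[OF \<open>N \<le> n\<close>] gamma_less by (simp add: field_simps max_def)
      finally show ?thesis .
    qed
    then show "\<exists>N. \<forall>n n'. N \<le> n \<longrightarrow> N \<le> n' \<longrightarrow> d (\<sigma> n) (\<sigma> n') < \<epsilon>"
      by blast
  qed (use \<sigma> in auto)
  then obtain a where a: "limitin mtopology \<sigma> a sequentially"
    using \<open>mcomplete\<close> by (auto simp: mcomplete_def)
  have "(\<lambda>n. d (\<sigma> n) (S (\<sigma> n))) \<longlonglongrightarrow> 0" "(\<lambda>n. d (\<sigma> n) (T (\<sigma> n))) \<longlonglongrightarrow> 0"
    using \<sigma>S \<sigma>T by (auto intro!: tendsto_sandwich[OF _ _ tendsto_const e0])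
  then have "S a = a" "T a = a"
    using limit_of_displacement_null_fixed[OF S_cont a \<sigma>]
      limit_of_displacement_null_fixed[OF T_cont a \<sigma>] by auto
  moreover have "a \<in> M"
    using a by (simp add: limitin_metric)
  ultimately show ?thesis
    by blast
qed

text \<open>By commutation the \<open>T\<close>-orbit of \<open>a\<close> consists of fixed points
  of \<open>S\<close>. Since \<open>S\<close> preserves distances between these, \<open>T\<close>
  must contract each pair of distinct consecutive ones.\<close>

lemma almost_fixed_if_S_fixed:
  assumes "a \<in> M" "S a = a" "0 < \<epsilon>"
  shows "\<exists>x\<in>M. d x (S x) \<le> \<epsilon> \<and> d x (T x) \<le> \<epsilon>"
proof -
  define \<tau> where "\<tau> n = (T ^^ n) a" for n
  have \<tau>_Suc: "\<tau> (Suc n) = T (\<tau> n)" for n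
    by (simp add: \<tau>_def)
  have \<tau>: "\<tau> n \<in> M \<and> S (\<tau> n) = \<tau> n" for n
    by (induction n) (use assms ST in \<open>auto simp: \<tau>_def\<close>)
  have bound: "d (\<tau> n) (T (\<tau> n)) \<le> \<gamma> ^ n * d a (T a)" for n
  proof (induction n)
    case 0
    then show ?case by (simp add: \<tau>_def)
  next
    case (Suc n)
    have "d (\<tau> (Suc n)) (T (\<tau> (Suc n))) \<le> \<gamma> * d (\<tau> n) (T (\<tau> n))"
    \<comment> \<open>Equal points have to be split off, because \<open>S\<close> does satisfy the
      contraction inequality at distance zero.\<close>
    proof (cases "\<tau> (Suc n) = \<tau> n")
      case True
      then have "T (\<tau> n) = \<tau> n"
        by (simp add: \<tau>_Suc)
      with True \<tau>[of n] show ?thesis by simp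
    next
      case False
      then have "\<not> d (\<tau> n) (\<tau> (Suc n)) \<le> \<gamma> * d (\<tau> n) (\<tau> (Suc n))"
        using \<tau> gamma_less by (simp add: mdist_pos_eq)
      then show ?thesis
        using contr[of "\<tau> n" "\<tau> (Suc n)"] \<tau>[of n] \<tau>[of "Suc n"] by (simp add: \<tau>_Suc)
    qed
    also have "\<dots> \<le> \<gamma> * (\<gamma> ^ n * d a (T a))"
      using Suc gamma_pos by (intro mult_left_mono) auto
    finally show ?case by simp
  qed
  obtain n where "\<gamma> ^ n * d a (T a) < \<epsilon>"
    using power_mult_arbitrarily_small gamma_pos gamma_less \<open>0 < \<epsilon>\<close> by blast
  with bound[of n] \<tau>[of n] \<open>0 < \<epsilon>\<close> show ?thesis
    by (intro bexI[of _ "\<tau> n"]) auto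
qed

section \<open>Paths composed of steps \<open>S\<close> and \<open>T\<close>\<close>

lemma S_contracting_path:
  assumes "x \<in> M"
  obtains z where "z 0 = x" "\<And>k. z k \<in> M"
    "\<And>k. z (Suc k) = S (z k) \<or> z (Suc k) = T (z k)"
    "\<And>k. d (z k) (S (z k)) \<le> \<gamma> ^ k * d x (S x)"
proof -
  define step where
    "step y = (if d (S y) (S (S y)) \<le> \<gamma> * d y (S y) then S y else T y)" for y
  define z where "z k = (step ^^ k) x" for k
  have z_Suc: "z (Suc k) = step (z k)" for k
    by (simp add: z_def)
  have zM: "z k \<in> M" for k
    by (induction k) (use assms in \<open>auto simp: z_def step_def\<close>)
  \<comment> \<open>This is contractivity for the pair \<open>y\<close>, \<open>S y\<close>: if
    \<open>S\<close> does not contract it, \<open>T\<close> does, and by commutation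
    \<open>d (T y) (T (S y))\<close> is the displacement of \<open>T y\<close> under
    \<open>S\<close>.\<close>
  have step: "d (step y) (S (step y)) \<le> \<gamma> * d y (S y)" if "y \<in> M" for y
    using contr[of y "S y"] that by (auto simp: step_def ST)
  have "d (z k) (S (z k)) \<le> \<gamma> ^ k * d x (S x)" for k
  proof (induction k)
    case 0
    then show ?case by (simp add: z_def)
  next
    case (Suc k)
    have "d (z (Suc k)) (S (z (Suc k))) \<le> \<gamma> * d (z k) (S (z k))"
      unfolding z_Suc by (intro step zM)
    also have "\<dots> \<le> \<gamma> * (\<gamma> ^ k * d x (S x))"
      using Suc gamma_pos by (intro mult_left_mono) auto
    finally show ?case by simp
  qed
  with zM show ?thesis
    by (intro that[of z]) (auto simp: z_Suc step_def, simp add: z_def)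
qed

lemma almost_fixed_along_T_steps:
  assumes "0 < \<epsilon>" and y: "\<And>j. y j \<in> M"
    and yS: "\<And>j. d (y j) (S (y j)) \<le> \<epsilon>"
    and yT: "\<And>j. d (T (y j)) (y (Suc j)) \<le> \<epsilon>"
  shows "\<exists>j. d (y j) (T (y j)) \<le> 2 * \<epsilon> / (1 - \<gamma>) + 2 * \<epsilon>"
proof -
  \<comment> \<open>The number \<open>c\<close> has two roles: it is the bound of
    \<open>dist_le_if_contracted\<close>, so \<open>S\<close> cannot contract a pair further apart
    than \<open>c\<close>, and it is the fixed point of
    \<open>t \<mapsto> \<gamma> * t + 2 * \<epsilon>\<close>, the recursion that bounds
    \<open>D\<close>.\<close>
  define c where "c = 2 * \<epsilon> / (1 - \<gamma>)"
  define D where "D j = d (y j) (y (Suc j))" for j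
  have "\<exists>j. D j \<le> c + \<epsilon>"
  \<comment> \<open>If all \<open>D j\<close> exceed \<open>c + \<epsilon>\<close>, then
    \<open>T\<close> contracts every consecutive pair, so the excess \<open>D j - c\<close> decays
    geometrically and finally drops below \<open>\<epsilon>\<close>.\<close>
  proof (rule ccontr)
    assume "\<nexists>j. D j \<le> c + \<epsilon>"
    then have large: "c + \<epsilon> < D j" for j
      by (simp add: not_le)
    have step: "D (Suc j) - c \<le> \<gamma> * (D j - c)" for j
    proof -
      have "\<not> d (S (y j)) (S (y (Suc j))) \<le> \<gamma> * d (y j) (y (Suc j))"
        using dist_le_if_contracted[where U = S, OF y y _ _ _ yS yS, of j "Suc j"]
          large[of j] y \<open>0 < \<epsilon>\<close> by (auto simp: D_def c_def)
      then have "d (T (y j)) (T (y (Suc j))) \<le> \<gamma> * D j"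
        using contr[OF y y, of j "Suc j"] by (simp add: D_def)
      moreover have "D (Suc j) \<le> d (T (y j)) (y (Suc j)) + d (T (y j)) (T (y (Suc j)))
          + d (T (y (Suc j))) (y (Suc (Suc j)))"
        unfolding D_def
        using triangle[of "y (Suc j)" "T (y j)" "y (Suc (Suc j))"]
          triangle[of "T (y j)" "T (y (Suc j))" "y (Suc (Suc j))"] y by (simp add: commute)
      ultimately have "D (Suc j) \<le> \<gamma> * D j + 2 * \<epsilon>"
        using yT[of j] yT[of "Suc j"] by linarith
      also have "2 * \<epsilon> = c - \<gamma> * c"
        using gamma_less by (simp add: c_def divide_simps) (simp add: algebra_simps)
      finally show ?thesis by (simp add: algebra_simps)
    qed
    have "D j - c \<le> \<gamma> ^ j * (D 0 - c)" for j
    proof (induction j)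
      case (Suc j)
      have "D (Suc j) - c \<le> \<gamma> * (\<gamma> ^ j * (D 0 - c))"
        using step[of j] mult_left_mono[OF Suc, of \<gamma>] gamma_pos by linarith
      then show ?case by simp
    qed simp
    moreover obtain j where "\<gamma> ^ j * (D 0 - c) < \<epsilon>"
      using power_mult_arbitrarily_small gamma_pos gamma_less \<open>0 < \<epsilon>\<close> by blast
    ultimately show False
      using large[of j] by (smt (verit))
  qed
  then obtain j where "D j \<le> c + \<epsilon>" ..
  moreover have "d (y j) (T (y j)) \<le> D j + d (T (y j)) (y (Suc j))"
    unfolding D_def using triangle[of "y j" "y (Suc j)" "T (y j)"] y by (simp add: commute)
  ultimately show ?thesis
    using yT[of j] by (intro exI[of _ j]) (simp add: c_def)
qed

lemma S_fixed_point_if_S_orbit_contracts: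
  assumes "mcomplete" "0 \<le> C" and \<sigma>: "\<And>k. \<sigma> k \<in> M"
    and \<sigma>_Suc: "\<And>k. \<sigma> (Suc k) = S (\<sigma> k)"
    and bound: "\<And>k. d (\<sigma> k) (S (\<sigma> k)) \<le> \<gamma> ^ k * C"
  shows "\<exists>a\<in>M. S a = a"
proof -
  have "MCauchy \<sigma>"
    using geometric_steps_MCauchy[OF gamma_pos gamma_less \<open>0 \<le> C\<close> \<sigma>] bound by (simp add: \<sigma>_Suc)
  then obtain a where a: "limitin mtopology \<sigma> a sequentially"
    using \<open>mcomplete\<close> by (auto simp: mcomplete_def)
  have null: "(\<lambda>k. \<gamma> ^ k * C) \<longlonglongrightarrow> 0"
    using gamma_pos gamma_less by (intro tendsto_mult_left_zero LIMSEQ_realpow_zero) auto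
  have "(\<lambda>k. d (\<sigma> k) (S (\<sigma> k))) \<longlonglongrightarrow> 0"
    using bound by (intro tendsto_sandwich[OF _ _ tendsto_const null]) auto
  then have "S a = a"
    using limit_of_displacement_null_fixed[OF S_cont a \<sigma>] by simp
  then show ?thesis
    using a by (auto simp: limitin_metric)
qed

section \<open>Existence and uniqueness of the common fixed point\<close>

lemma almost_fixed:
  assumes "mcomplete" "x \<in> M" "0 < \<epsilon>"
  shows "\<exists>w\<in>M. d w (S w) \<le> \<epsilon> \<and> d w (T w) \<le> \<epsilon>"
proof -
  define C where "C = d x (S x)"
  have C: "0 \<le> C"
    by (simp add: C_def)
  obtain z where z: "\<And>k. z k \<in> M"
    and z_Suc: "\<And>k. z (Suc k) = S (z k) \<or> z (Suc k) = T (z k)"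
    and bound: "\<And>k. d (z k) (S (z k)) \<le> \<gamma> ^ k * C"
    using S_contracting_path[OF \<open>x \<in> M\<close>] unfolding C_def by metis
  show ?thesis
  proof (cases "\<exists>K. \<forall>k\<ge>K. z (Suc k) = S (z k)")
    case True
    then obtain K where K: "\<And>k. z (Suc (k + K)) = S (z (k + K))"
      using le_add2 by blast
    have "d (z (k + K)) (S (z (k + K))) \<le> \<gamma> ^ k * (\<gamma> ^ K * C)" for k
      using bound[of "k + K"] by (simp add: power_add)
    then have "\<exists>a\<in>M. S a = a"
      using C gamma_pos z K
      by (intro S_fixed_point_if_S_orbit_contracts[OF \<open>mcomplete\<close>,
            where \<sigma> = "\<lambda>k. z (k + K)" and C = "\<gamma> ^ K * C"]) auto
    then show ?thesis
      using almost_fixed_if_S_fixed \<open>0 < \<epsilon>\<close> by blast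
  next
    case False
    \<comment> \<open>Chosen so that the bound of \<open>almost_fixed_along_T_steps\<close>, taken
      at \<open>\<delta>\<close>, is exactly \<open>\<epsilon>\<close>.\<close>
    define \<delta> where "\<delta> = \<epsilon> / (2 / (1 - \<gamma>) + 2)"
    have pos: "0 < 2 / (1 - \<gamma>) + 2"
      using gamma_less by (simp add: add_pos_pos)
    have \<delta>: "0 < \<delta>" "2 * \<delta> / (1 - \<gamma>) + 2 * \<delta> = \<epsilon>"
    proof -
      show "0 < \<delta>"
        using pos \<open>0 < \<epsilon>\<close> by (simp add: \<delta>_def)
      have "\<delta> * (2 / (1 - \<gamma>) + 2) = \<epsilon>"
        using pos by (simp add: \<delta>_def)
      then show "2 * \<delta> / (1 - \<gamma>) + 2 * \<delta> = \<epsilon>"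
        by (simp add: algebra_simps)
    qed
    then have "\<delta> \<le> \<epsilon>"
      using gamma_less by (smt (verit) divide_nonneg_pos)
    \<comment> \<open>One \<open>K\<close> serves twice: \<open>C / (1 - \<gamma>)\<close> bounds
      the length of a run of \<open>S\<close> steps and, being at least \<open>C\<close>, also the
      displacements under \<open>S\<close>.\<close>
    obtain K where K: "\<And>k. k \<ge> K \<Longrightarrow> \<gamma> ^ k * (C / (1 - \<gamma>)) < \<delta>"
      using power_mult_arbitrarily_small gamma_pos gamma_less \<open>0 < \<delta>\<close> by metis
    have small: "d (z k) (S (z k)) \<le> \<delta>" if "K \<le> k" for k
    proof -
      have "C \<le> C / (1 - \<gamma>)"
        using C gamma_pos gamma_less by (simp add: pos_le_divide_eq mult_left_le)
      then have "\<gamma> ^ k * C \<le> \<gamma> ^ k * (C / (1 - \<gamma>))"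
        using gamma_pos by (intro mult_left_mono) auto
      with K[OF that] bound[of k] show ?thesis by linarith
    qed
    \<comment> \<open>Testing for a step other than \<open>S\<close> guarantees that between
      consecutive elements of \<open>I\<close> every step is \<open>S\<close>, even where
      \<open>S\<close> and \<open>T\<close> agree.\<close>
    define I where "I = {k. K \<le> k \<and> z (Suc k) \<noteq> S (z k)}"
    have "infinite I"
      unfolding infinite_nat_iff_unbounded_le
    proof
      fix m
      obtain k where "max K m \<le> k" "z (Suc k) \<noteq> S (z k)"
        using False by blast
      then show "\<exists>n\<ge>m. n \<in> I"
        by (auto simp: I_def)
    qed
    define e where "e = enumerate I"
    have eI: "e j \<in> I" and e_less: "e j < e (Suc j)" for j
      unfolding e_def using \<open>infinite I\<close> by (auto intro: enumerate_in_set enumerate_step)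
    \<comment> \<open>The next value of the enumeration is the least element of \<open>I\<close>
      above \<open>e j\<close>.\<close>
    have gap: "k \<notin> I" if "e j < k" "k < e (Suc j)" for j k
      using that not_less_Least[of k "\<lambda>s. s \<in> I \<and> e j < s"]
      unfolding e_def enumerate_Suc''[OF \<open>infinite I\<close>, of j] by auto
    have "\<exists>j. d (z (e j)) (T (z (e j))) \<le> 2 * \<delta> / (1 - \<gamma>) + 2 * \<delta>"
    proof (rule almost_fixed_along_T_steps[OF \<open>0 < \<delta>\<close>])
      fix j
      have "K \<le> e j"
        using eI[of j] by (simp add: I_def)
      have "z (Suc (e j)) = T (z (e j))"
        using eI[of j] z_Suc[of "e j"] by (auto simp: I_def)
      \<comment> \<open>After the step \<open>T\<close> at time \<open>e j\<close> only
        \<open>S\<close> steps follow until time \<open>e (Suc j)\<close>. Their lengths are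
        displacements under \<open>S\<close>, so they sum to a geometric tail.\<close>
      moreover have "d (z (Suc (e j))) (z (e (Suc j))) \<le> \<gamma> ^ Suc (e j) * (C / (1 - \<gamma>))"
      proof (rule geometric_chain_dist[OF gamma_pos gamma_less C _ z])
        fix k assume "Suc (e j) \<le> k" "k < e (Suc j)"
        then have "z (Suc k) = S (z k)"
          using gap[of j k] \<open>K \<le> e j\<close> by (auto simp: I_def)
        then show "d (z k) (z (Suc k)) \<le> \<gamma> ^ k * C"
          using bound[of k] by simp
      qed (use e_less in \<open>simp add: Suc_le_eq\<close>)
      ultimately show "d (T (z (e j))) (z (e (Suc j))) \<le> \<delta>"
        using K[of "Suc (e j)"] \<open>K \<le> e j\<close> by simp
    qed (use z small eI in \<open>auto simp: I_def\<close>)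
    then obtain j where "d (z (e j)) (T (z (e j))) \<le> \<epsilon>"
      using \<delta>(2) by auto
    moreover have "d (z (e j)) (S (z (e j))) \<le> \<epsilon>"
      using small[of "e j"] eI[of j] \<open>\<delta> \<le> \<epsilon>\<close> by (simp add: I_def)
    ultimately show ?thesis
      using z by blast
  qed
qed

theorem ex1_common_fixed_point:
  assumes "mcomplete" "M \<noteq> {}"
  shows "\<exists>!x. x \<in> M \<and> S x = x \<and> T x = x"
proof -
  obtain x where x: "x \<in> M" "S x = x" "T x = x"
    using common_fixed_point_if_almost_fixed almost_fixed assms by blast
  \<comment> \<open>Whichever map contracts the pair leaves both points in place, so their distance
    is at most \<open>\<gamma>\<close> times itself.\<close>
  have "y = x" if y: "y \<in> M" "S y = y" "T y = y" for y
  proof -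
    have "d y x \<le> \<gamma> * d y x"
      using contr[of y x] x y by auto
    then have "d y x \<le> 0"
      using gamma_less by (smt (verit) mult_le_cancel_right1)
    then show ?thesis
      using x y by (metis mdist_pos_less not_le)
  qed
  with x show ?thesis by blast
qed

end

theorem theorem3p4:
  fixes X :: "'a set" and \<rho> :: "'a \<Rightarrow> 'a \<Rightarrow> real" and S T :: "'a \<Rightarrow> 'a"
  assumes "Metric_space X \<rho>"
    and "X \<noteq> {}"
    and "Metric_space.mcomplete X \<rho>"
    and "Metric_space.self_map X \<rho> S"
    and "Metric_space.self_map X \<rho> T"
    and "Metric_space.commuting X {S, T}"
    and "Metric_space.contractive X \<rho> {S, T}"
  shows "\<exists>!x. x \<in> X \<and> S x = x \<and> T x = x"
proof -
  interpret Metric_space X \<rho>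
    by fact
  obtain \<gamma> where "gamma_contractive \<gamma> {S, T}"
    using assms(7) by (auto simp: contractive_def)
  then have \<gamma>: "0 < \<gamma>" "\<gamma> < 1"
      "\<And>x y. \<lbrakk>x \<in> X; y \<in> X\<rbrakk> \<Longrightarrow> \<rho> (S x) (S y) \<le> \<gamma> * \<rho> x y \<or> \<rho> (T x) (T y) \<le> \<gamma> * \<rho> x y"
    by (auto simp: gamma_contractive_def)
  have ST: "S (T x) = T (S x)" if "x \<in> X" for x
    using assms(6) that unfolding commuting_def by blast
  interpret commuting_contractive_pair X \<rho> S T \<gamma>
    using assms(4,5) \<gamma> ST by unfold_locales (auto simp only: self_map_def)
  show ?thesis
    using ex1_common_fixed_point assms by blast
qed

end
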